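(* Consider an instance $(X,U)$ of dimension $n$ of a problem class with cardinality bounds $\underline p,\bar p$ (with $\underline p(n)>0$) and cost bounds $0<m_\infty\le M_\infty$. Let $\tilde M(n):=\frac{M_\infty}{m_\infty}\frac{\bar p(n)}{\underline p(n)}$, let $a:\mathbb N\to\mathbb R_+$, and let $k=qn$ be an integer with $q\in(0,1]$. Then, for all $$q\in\left[\frac{\tilde M(n)}{\tilde M(n)+a(n)},\,1\right],$$ the solution returned by the selection algorithm (Algorithm 1, described in the context) has multiplicative approximation guarantee at most $a(n)$, i.e. $\mathrm{approx}(k)\le(1+a(n))\,\mathrm{opt}(k)$.
   Context: Notation: $\mathbb N=\{1,2,\dots\}$, $[k]=\{1,\dots,k\}$, $\mathbb R_+^n=\{x\in\mathbb R^n: x\ge 0\}$, and $\|x\|_0$ is the number of non-zero entries of $x$. An instance of dimension $n$ consists of a nonempty set $X\subseteq\{0,1\}^n$ and a nonempty convex set $U\subseteq\mathbb R_+^n$; all minima and maxima written are understood to be attained (e.g. $U$ compact). For $k\in\mathbb N$ the min-max-min robust problem $(\mathrm M^3(k))$ is $$\min_{x^{(1)},\dots,x^{(k)}\in X}\ \max_{c\in U}\ \min_{i=1,\dots,k} c^\top x^{(i)},$$ and $\mathrm{opt}(k)$ denotes its optimal value. A problem class has cardinality bounds $\underline p,\bar p:\mathbb N\to\mathbb R_+$ if for every instance of dimension $n$ in the class $\underline p(n)\le\|x\|_0\le\bar p(n)$ for all $x\in X$. Cost bounds $0<m_\infty\le M_\infty$ means that $m_\infty\le c_j\le M_\infty$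 for all $c\in U$ and all $j\in[n]$. Algorithm 1 (input $n$, $k\in[n]$, $U$, $X$): (1) compute an optimal solution $x^1,\dots,x^n$ of $(\mathrm M^3(n))$; (2) compute an optimal solution $\lambda^*$ of $\min\{\max_{c\in U}c^\top x:\ x=\sum_{i=1}^n\lambda_i x^i,\ \sum_{i=1}^n\lambda_i=1,\ \lambda\ge 0\}$; (3) sort $\lambda^*_{i_1}\ge\lambda^*_{i_2}\ge\dots\ge\lambda^*_{i_n}$; (4) return $x^{i_1},\dots,x^{i_k}$. The objective value of the returned solution is $\mathrm{approx}(k):=\max_{c\in U}\min_{j=1,\dots,k}c^\top x^{i_j}$. *)

theory Defs
  imports "HOL-Analysis.Analysis"
begin

text \<open>The dimension \<open>n\<close> is \<open>CARD('n)\<close>. Tuples \<open>x\<^sup>(\<^sup>1\<^sup>), \<dots>, x\<^sup>(\<^sup>k\<^sup>)\<close> are extensional functions on \<open>{1..k}\<close>.\<close>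

definition nonzeros :: "real ^ 'n \<Rightarrow> nat" where
  "nonzeros x = card {j. x $ j \<noteq> 0}"

definition robust_instance :: "(real ^ 'n) set \<Rightarrow> (real ^ 'n) set \<Rightarrow> bool" where
  "robust_instance X U \<longleftrightarrow>
     X \<noteq> {} \<and> (\<forall>x\<in>X. \<forall>j. x $ j \<in> {0, 1}) \<and>
     U \<noteq> {} \<and> convex U \<and> (\<forall>c\<in>U. \<forall>j. 0 \<le> c $ j)"

text \<open>A problem class contains instances of every dimension. Since the dimension is a type,
  \<open>C\<close> is the part of the class that consists of its instances of dimension \<open>CARD('n)\<close>.\<close>

definition problem_class :: "((real ^ 'n) set \<times> (real ^ 'n) set) set \<Rightarrow> bool" where
  "problem_class C \<longleftrightarrow> (\<forall>(X, U)\<in>C. robust_instance X U)"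

definition cardinality_bounds ::
  "((real ^ 'n) set \<times> (real ^ 'n) set) set \<Rightarrow> (nat \<Rightarrow> real) \<Rightarrow> (nat \<Rightarrow> real) \<Rightarrow> bool" where
  "cardinality_bounds C p_low p_up \<longleftrightarrow>
     (\<forall>(X, U)\<in>C. \<forall>x\<in>X. p_low CARD('n) \<le> real (nonzeros x) \<and> real (nonzeros x) \<le> p_up CARD('n))"

definition cost_bounds :: "(real ^ 'n) set \<Rightarrow> real \<Rightarrow> real \<Rightarrow> bool" where
  "cost_bounds U m M \<longleftrightarrow> 0 < m \<and> m \<le> M \<and> (\<forall>c\<in>U. \<forall>j. m \<le> c $ j \<and> c $ j \<le> M)"

definition min_cost :: "nat \<Rightarrow> (nat \<Rightarrow> real ^ 'n) \<Rightarrow> real ^ 'n \<Rightarrow> real" where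
  "min_cost k x c = Min ((\<lambda>i. c \<bullet> x i) ` {1..k})"

text \<open>The suprema over \<open>U\<close> below are maxima whenever \<open>maxima_attained X U\<close> holds.\<close>

definition m3_value :: "(real ^ 'n) set \<Rightarrow> nat \<Rightarrow> (nat \<Rightarrow> real ^ 'n) \<Rightarrow> real" where
  "m3_value U k x = (SUP c\<in>U. min_cost k x c)"

text \<open>The outer minimum is over a finite set, because \<open>X \<subseteq> {0,1}\<^sup>n\<close>.\<close>

definition m3_opt :: "(real ^ 'n) set \<Rightarrow> (real ^ 'n) set \<Rightarrow> nat \<Rightarrow> real" where
  "m3_opt X U k = Min (m3_value U k ` ({1..k} \<rightarrow>\<^sub>E X))"

definition m3_optimal :: "(real ^ 'n) set \<Rightarrow> (real ^ 'n) set \<Rightarrow> nat \<Rightarrow> (nat \<Rightarrow> real ^ 'n) \<Rightarrow> bool" where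
  "m3_optimal X U k x \<longleftrightarrow> is_arg_min (m3_value U k) (\<lambda>y. y \<in> {1..k} \<rightarrow>\<^sub>E X) x"

definition worst_cost :: "(real ^ 'n) set \<Rightarrow> real ^ 'n \<Rightarrow> real" where
  "worst_cost U z = (SUP c\<in>U. c \<bullet> z)"

definition convex_weights :: "nat \<Rightarrow> (nat \<Rightarrow> real) \<Rightarrow> bool" where
  "convex_weights n l \<longleftrightarrow> (\<forall>i\<in>{1..n}. 0 \<le> l i) \<and> (\<Sum>i=1..n. l i) = 1"

definition combination :: "nat \<Rightarrow> (nat \<Rightarrow> real ^ 'n) \<Rightarrow> (nat \<Rightarrow> real) \<Rightarrow> real ^ 'n" where
  "combination n x l = (\<Sum>i=1..n. l i *\<^sub>R x i)"

text \<open>Attainment of the inner maxima of the min-max-min problems and of the convex problem over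
  the weights; it holds for instance if \<open>U\<close> is compact.\<close>

definition maxima_attained :: "(real ^ 'n) set \<Rightarrow> (real ^ 'n) set \<Rightarrow> bool" where
  "maxima_attained X U \<longleftrightarrow>
     (\<forall>k\<ge>1. \<forall>x\<in>{1..k} \<rightarrow>\<^sub>E X. \<exists>c. is_arg_max (min_cost k x) (\<lambda>c. c \<in> U) c) \<and>
     (\<forall>x\<in>{1..CARD('n)} \<rightarrow>\<^sub>E X. \<forall>l. convex_weights CARD('n) l \<longrightarrow>
        (\<exists>c. is_arg_max (\<lambda>c. c \<bullet> combination CARD('n) x l) (\<lambda>c. c \<in> U) c))"

text \<open>The algorithm is nondeterministic: optimal solutions and the order of equal weights may be
  chosen arbitrarily. The predicate holds for every possible output \<open>y\<close>.\<close>

definition selection_output ::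
  "(real ^ 'n) set \<Rightarrow> (real ^ 'n) set \<Rightarrow> nat \<Rightarrow> (nat \<Rightarrow> real ^ 'n) \<Rightarrow> bool" where
  "selection_output X U k y \<longleftrightarrow>
     (\<exists>x l s.
        m3_optimal X U CARD('n) x \<and>
        is_arg_min (\<lambda>l. worst_cost U (combination CARD('n) x l)) (convex_weights CARD('n)) l \<and>
        bij_betw s {1..CARD('n)} {1..CARD('n)} \<and>
        (\<forall>i\<in>{1..CARD('n)}. \<forall>j\<in>{1..CARD('n)}. i \<le> j \<longrightarrow> l (s j) \<le> l (s i)) \<and>
        y = (\<lambda>j\<in>{1..k}. x (s j)))"

definition M_tilde ::
  "real \<Rightarrow> real \<Rightarrow> (nat \<Rightarrow> real) \<Rightarrow> (nat \<Rightarrow> real) \<Rightarrow> nat \<Rightarrow> real" where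
  "M_tilde m M p_low p_up n = M / m * (p_up n / p_low n)"

end

theory Submission imports Defs begin

text \<open>By the minimax theorem, the optimal convex combination of an optimal \<open>n\<close>-tuple costs at most
  \<open>opt(n)\<close>, hence at most \<open>opt(k)\<close>, in every scenario. The \<open>k\<close> largest weights sum to at least \<open>k/n = q\<close>, and
  costs are nonnegative, so in every scenario the cheapest of the \<open>k\<close> selected solutions costs at
  most \<open>opt(n) / q\<close>. Finally \<open>1 / q \<le> 1 + a / M_tilde \<le> 1 + a\<close>, because \<open>M_tilde \<ge> 1\<close>.\<close>

section \<open>The minimax theorem for finitely many solutions\<close>

text \<open>The separating hyperplane between the cost vectors of the scenarios and the open orthant above
  \<open>v\<close> has a nonnegative normal vector; normalised, it gives the weights.\<close>

lemma minimax_weights: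
  fixes x :: "'i::finite \<Rightarrow> 'a::real_inner" and U :: "'a set" and v :: real
  assumes "convex U" "U \<noteq> {}" and low: "\<And>c. c \<in> U \<Longrightarrow> \<exists>i. c \<bullet> x i \<le> v"
  shows "\<exists>l. (\<forall>i. 0 \<le> l i) \<and> sum l UNIV = 1 \<and> (\<forall>c\<in>U. c \<bullet> (\<Sum>i\<in>UNIV. l i *\<^sub>R x i) \<le> v)"
proof -
  define f :: "'a \<Rightarrow> real ^ 'i" where "f c = (\<chi> i. c \<bullet> x i)" for c
  define T :: "(real ^ 'i) set" where "T = {w. \<forall>i. v < w $ i}"
  have "linear f"
    by (rule linearI) (simp_all add: f_def vec_eq_iff inner_add_left)
  then have "convex (f ` U)"
    using assms(1) by (rule convex_linear_image)
  moreover have "convex T"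
  proof -
    have "T = (\<Inter>i. {w. axis i 1 \<bullet> w > v})"
      by (auto simp: T_def inner_axis' )
    then show ?thesis
      by (auto intro!: convex_INT convex_halfspace_gt)
  qed
  moreover have "f ` U \<noteq> {}"
    using assms(2) by simp
  moreover have "(\<chi> i. v + 1) \<in> T"
    by (simp add: T_def)
  then have "T \<noteq> {}"
    by blast
  \<comment> \<open>A common point would be a scenario in which every \<open>x i\<close> costs more
    than \<open>v\<close>, against \<open>low\<close>.\<close>
  moreover have "f ` U \<inter> T = {}"
    using low by (auto simp: T_def f_def) (meson not_less)
  ultimately obtain a b where a: "a \<noteq> 0" and U: "\<And>c. c \<in> U \<Longrightarrow> a \<bullet> f c \<le> b"
    and T: "\<And>w. w \<in> T \<Longrightarrow> b \<le> a \<bullet> w"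
    using separating_hyperplane_sets[of "f ` U" T] by (metis image_eqI)
  define A where "A = (\<Sum>i\<in>UNIV. a $ i)"
  have nonneg: "0 \<le> a $ i" for i
  proof (rule ccontr)
    assume neg: "\<not> 0 \<le> a $ i"
    \<comment> \<open>Moving a point of \<open>T\<close> upwards along axis \<open>i\<close> stays
      in \<open>T\<close>. With \<open>a $ i < 0\<close>, the length \<open>t\<close> is chosen so
      that the inner product with \<open>a\<close> becomes exactly \<open>b + a $ i\<close>, which
      is below \<open>b\<close>.\<close>
    define K where "K = a \<bullet> (\<chi> i. v + 1)"
    define t where "t = (K - b) / (- a $ i) + 1"
    have "b \<le> K"
      unfolding K_def by (rule T) fact
    then have "0 \<le> t"
      using neg by (simp add: t_def divide_nonneg_neg)
    then have "(\<chi> i. v + 1) + t *\<^sub>R axis i 1 \<in> T"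
      by (simp add: T_def axis_def add_pos_nonneg)
    then have "b \<le> K + t * a $ i"
      using T by (fastforce simp: K_def inner_add_right inner_axis)
    also have "\<dots> = b + a $ i"
      using neg by (simp add: t_def field_simps)
    finally show False
      using neg by simp
  qed
  have "A > 0"
  proof -
    obtain j where "a $ j \<noteq> 0"
      using a by (auto simp: vec_eq_iff)
    then have "0 < a $ j"
      using nonneg[of j] by simp
    then show ?thesis
      unfolding A_def using nonneg by (intro sum_pos2[of _ j]) auto
  qed
  \<comment> \<open>The constant vector \<open>v\<close> lies only on the boundary of the open
    orthant \<open>T\<close>. It is approached by \<open>v + e / A\<close>, where dividing by
    \<open>A\<close> makes the error in the inner product equal to \<open>e\<close>.\<close>
  have b: "b \<le> v * A"
  proof (rule field_le_epsilon)
    fix e :: real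
    assume "e > 0"
    then have "(\<chi> i. v + e / A) \<in> T"
      using \<open>A > 0\<close> by (simp add: T_def)
    then have "b \<le> a \<bullet> (\<chi> i. v + e / A)"
      by (rule T)
    also have "\<dots> = (v + e / A) * A"
      by (simp add: inner_vec_def A_def flip: sum_distrib_right)
    also have "\<dots> = v * A + e"
      using \<open>A > 0\<close> by (simp add: field_simps)
    finally show "b \<le> v * A + e" .
  qed
  have "c \<bullet> (\<Sum>i\<in>UNIV. (a $ i / A) *\<^sub>R x i) \<le> v" if "c \<in> U" for c
  proof -
    have "c \<bullet> (\<Sum>i\<in>UNIV. (a $ i / A) *\<^sub>R x i) = (a \<bullet> f c) / A"
      by (simp add: inner_sum_right inner_vec_def f_def sum_divide_distrib)
    also have "\<dots> \<le> v"
      using U[OF that] b \<open>A > 0\<close> by (simp add: field_simps)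
    finally show ?thesis .
  qed
  moreover have "(\<Sum>i\<in>UNIV. a $ i / A) = 1"
    using \<open>A > 0\<close> by (simp add: A_def flip: sum_divide_distrib)
  ultimately show ?thesis
    using nonneg \<open>A > 0\<close> by (intro exI[of _ "\<lambda>i. a $ i / A"]) simp
qed

text \<open>Separation takes place in a space of vectors indexed by a finite type. Since there are
  as many solutions as elements of \<open>'n\<close>, a bijection \<open>h\<close> carries the
  weights over to the indices \<open>1, ..., CARD('n)\<close>.\<close>

lemma minimax_combination:
  fixes x :: "nat \<Rightarrow> real ^ 'n" and U :: "(real ^ 'n) set"
  assumes "convex U" "U \<noteq> {}"
    and "\<And>c. c \<in> U \<Longrightarrow> \<exists>i\<in>{1..CARD('n)}. c \<bullet> x i \<le> v"
  shows "\<exists>l. convex_weights CARD('n) l \<and> (\<forall>c\<in>U. c \<bullet> combination CARD('n) x l \<le> v)"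
proof -
  obtain h where h: "bij_betw h (UNIV :: 'n set) {1..CARD('n)}"
    using finite_same_card_bij[of "UNIV :: 'n set" "{1..CARD('n)}"] by auto
  have "\<exists>j. c \<bullet> x (h j) \<le> v" if "c \<in> U" for c
    using assms(3)[OF that] h by (metis bij_betw_def imageE)
  then obtain l where l: "\<And>j. 0 \<le> l j" "sum l UNIV = 1"
    "\<And>c. c \<in> U \<Longrightarrow> c \<bullet> (\<Sum>j\<in>UNIV. l j *\<^sub>R x (h j)) \<le> v"
    using minimax_weights[OF assms(1,2), of "\<lambda>j. x (h j)" v] by blast
  \<comment> \<open>\<open>h\<close> is injective on the whole type, so \<open>inv h\<close> undoes
    it. Values of \<open>l'\<close> outside \<open>{1..CARD('n)}\<close> enter no sum.\<close>
  define l' where "l' i = l (inv h i)" for i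
  have l': "l' (h j) = l j" for j
    using h by (simp add: l'_def bij_betw_def)
  have sum: "(\<Sum>i=1..CARD('n). l' i) = sum l UNIV"
    using sum.reindex_bij_betw[OF h, of l'] by (simp add: l')
  have "combination CARD('n) x l' = (\<Sum>j\<in>UNIV. l j *\<^sub>R x (h j))"
    using sum.reindex_bij_betw[OF h, of "\<lambda>i. l' i *\<^sub>R x i"] by (simp add: l' combination_def)
  then have "convex_weights CARD('n) l' \<and> (\<forall>c\<in>U. c \<bullet> combination CARD('n) x l' \<le> v)"
    using l sum by (simp add: convex_weights_def l'_def)
  then show ?thesis
    by blast
qed

section \<open>Leading partial sums of sorted weights\<close>

text \<open>Both blocks are compared with \<open>f k\<close>: it bounds every later term from above
  and every term up to \<open>k\<close> from below, so the average of the first \<open>k\<close>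
  terms is at least the overall average.\<close>

lemma antitone_prefix_sum:
  fixes f :: "nat \<Rightarrow> real"
  assumes anti: "\<And>i j. \<lbrakk>1 \<le> i; i \<le> j; j \<le> n\<rbrakk> \<Longrightarrow> f j \<le> f i" and k: "1 \<le> k" "k \<le> n"
  shows "real k * sum f {1..n} \<le> real n * sum f {1..k}"
proof -
  have split: "sum f {1..n} = sum f {1..k} + sum f {k+1..n}"
    using k by (metis le_add2 sum.ub_add_nat le_add_diff_inverse)
  have "sum f {k+1..n} \<le> real (card {k+1..n}) * f k"
    using anti k by (intro sum_bounded_above) auto
  then have tail: "sum f {k+1..n} \<le> (real n - real k) * f k"
    using k by (simp add: of_nat_diff)
  have "real (card {1..k}) * f k \<le> sum f {1..k}"
    using anti k by (intro sum_bounded_below) auto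
  then have init: "real k * f k \<le> sum f {1..k}"
    by simp
  have "real k * sum f {k+1..n} \<le> real k * ((real n - real k) * f k)"
    using tail by (intro mult_left_mono) auto
  also have "\<dots> = (real n - real k) * (real k * f k)"
    by simp
  also have "\<dots> \<le> (real n - real k) * sum f {1..k}"
    using init k by (intro mult_left_mono) auto
  finally show ?thesis
    unfolding split by (simp add: algebra_simps)
qed

section \<open>Costs of tuples and elementary properties of instances\<close>

lemma min_cost_le:
  assumes "i \<in> {1..k}"
  shows "min_cost k x c \<le> c \<bullet> x i"
  using assms unfolding min_cost_def by (intro Min_le) auto

lemma min_cost_ge_iff:
  assumes "1 \<le> k"
  shows "b \<le> min_cost k x c \<longleftrightarrow> (\<forall>i\<in>{1..k}. b \<le> c \<bullet> x i)"
  using assms unfolding min_cost_def by (subst Min_ge_iff) auto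

lemma min_cost_attained:
  assumes "1 \<le> k"
  shows "\<exists>i\<in>{1..k}. min_cost k x c = c \<bullet> x i"
proof -
  have "min_cost k x c \<in> (\<lambda>i. c \<bullet> x i) ` {1..k}"
    using assms unfolding min_cost_def by (intro Min_in) auto
  then show ?thesis
    by auto
qed

lemma bdd_above_inner:
  fixes U :: "'a::real_inner set"
  assumes "bounded U"
  shows "bdd_above ((\<lambda>c. c \<bullet> z) ` U)"
proof -
  have "bounded ((\<lambda>c. c \<bullet> z) ` U)"
    using assms by (rule bounded_linear_image) (rule bounded_linear_inner_left)
  then show ?thesis
    by (rule bounded_imp_bdd_above)
qed

lemma bdd_above_min_cost:
  assumes "bounded U" "1 \<le> k"
  shows "bdd_above (min_cost k x ` U)"
proof -
  obtain B where "\<And>c. c \<in> U \<Longrightarrow> c \<bullet> x 1 \<le> B"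
    using bdd_above_inner[OF assms(1), of "x 1"] by (auto simp: bdd_above_def)
  moreover have "min_cost k x c \<le> c \<bullet> x 1" for c
    using assms(2) by (intro min_cost_le) auto
  ultimately show ?thesis
    by (intro bdd_aboveI2[of _ _ B]) (meson order_trans)
qed

text \<open>\<open>U\<close> lies in a box. Boundedness makes each \<open>SUP\<close> over
  \<open>U\<close> a genuine upper bound on the costs in the single scenarios.\<close>

lemma bounded_cost_bounds:
  fixes U :: "(real ^ 'n) set"
  assumes "cost_bounds U m M"
  shows "bounded U"
proof (rule bounded_subset)
  show "bounded {(\<chi> j. m) .. (\<chi> j. M) :: real ^ 'n}"
    by simp
  show "U \<subseteq> {(\<chi> j. m) .. (\<chi> j. M)}"
    using assms by (auto simp: cost_bounds_def less_eq_vec_def)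
qed

text \<open>Needed so that there are finitely many tuples and the \<open>Min\<close> in
  \<open>m3_opt\<close> is a true minimum.\<close>

lemma robust_instance_finite:
  fixes X U :: "(real ^ 'n) set"
  assumes "robust_instance X U"
  shows "finite X"
proof (rule finite_subset)
  show "X \<subseteq> vec_lambda ` (UNIV \<rightarrow> {0, 1})"
  proof
    fix x
    assume "x \<in> X"
    then have "(\<lambda>j. x $ j) \<in> UNIV \<rightarrow> {0, 1}"
      using assms unfolding robust_instance_def by blast
    then show "x \<in> vec_lambda ` (UNIV \<rightarrow> {0, 1})"
      by (metis image_eqI vec_nth_inverse)
  qed
  \<comment> \<open>Extensionality over \<open>UNIV\<close> is no restriction, so this is the full
    function space.\<close>
  have "finite (UNIV \<rightarrow>\<^sub>E {0, 1} :: ('n \<Rightarrow> real) set)"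
    by (intro finite_PiE) auto
  then show "finite (vec_lambda ` (UNIV \<rightarrow> {0, 1}) :: (real ^ 'n) set)"
    by (simp add: PiE_def)
qed

lemma robust_instance_inner_nonneg:
  assumes "robust_instance X U" "c \<in> U" "x \<in> X"
  shows "0 \<le> c \<bullet> x"
proof -
  have "0 \<le> c $ j" "x $ j \<in> {0, 1}" for j
    using assms unfolding robust_instance_def by blast+
  then show ?thesis
    unfolding inner_vec_def by (intro sum_nonneg) (metis empty_iff insert_iff inner_real_def mult.right_neutral mult_zero_right order_refl)
qed

section \<open>The optimal value of the min-max-min problem\<close>

lemma m3_opt_le:
  assumes "robust_instance X U" "x \<in> {1..k} \<rightarrow>\<^sub>E X"
  shows "m3_opt X U k \<le> m3_value U k x"
  unfolding m3_opt_def using assms robust_instance_finite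
  by (intro Min_le) (auto intro!: finite_PiE)

lemma m3_opt_attained:
  assumes "robust_instance X U"
  shows "\<exists>x\<in>{1..k} \<rightarrow>\<^sub>E X. m3_opt X U k = m3_value U k x"
proof -
  have "m3_opt X U k \<in> m3_value U k ` ({1..k} \<rightarrow>\<^sub>E X)"
    unfolding m3_opt_def using assms robust_instance_finite[OF assms]
    by (intro Min_in) (auto intro!: finite_PiE simp: PiE_eq_empty_iff robust_instance_def)
  then show ?thesis
    by auto
qed

text \<open>An optimal \<open>k\<close>-tuple is padded to length \<open>n\<close> by repeating its
  last entry, which leaves the cheapest cost in each scenario unchanged.\<close>

lemma m3_opt_antimono:
  fixes X U :: "(real ^ 'n) set"
  assumes inst: "robust_instance X U" and "bounded U" and kn: "1 \<le> k" "k \<le> n"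
  shows "m3_opt X U n \<le> m3_opt X U k"
proof -
  obtain x where x: "x \<in> {1..k} \<rightarrow>\<^sub>E X" "m3_opt X U k = m3_value U k x"
    using m3_opt_attained[OF inst] by blast
  define z where "z = (\<lambda>i\<in>{1..n}. x (min i k))"
  have "z \<in> {1..n} \<rightarrow>\<^sub>E X"
    using x(1) kn by (auto simp: z_def PiE_iff)
  then have "m3_opt X U n \<le> m3_value U n z"
    by (rule m3_opt_le[OF inst])
  also have "\<dots> \<le> m3_value U k x"
    unfolding m3_value_def
  proof (rule cSUP_mono)
    show "U \<noteq> {}"
      using inst by (simp add: robust_instance_def)
    show "bdd_above (min_cost k x ` U)"
      using assms by (intro bdd_above_min_cost)
    fix c
    assume "c \<in> U"
    have "min_cost n z c \<le> c \<bullet> x i" if "i \<in> {1..k}" for i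
      using min_cost_le[of i n z c] that kn by (simp add: z_def min_absorb1)
    then have "min_cost n z c \<le> min_cost k x c"
      using min_cost_ge_iff[OF kn(1)] by blast
    then show "\<exists>c'\<in>U. min_cost n z c \<le> min_cost k x c'"
      using \<open>c \<in> U\<close> by blast
  qed
  finally show ?thesis
    using x(2) by simp
qed

section \<open>From the optimal combination to the selected solutions\<close>

text \<open>In each scenario some \<open>x i\<close> costs at most the value \<open>v\<close> of the
  tuple. Minimax turns this into one combination that is good in all scenarios, and the optimal
  weights \<open>l\<close> have no larger worst cost.\<close>

lemma optimal_combination_le_m3_opt:
  fixes X U :: "(real ^ 'n) set"
  assumes inst: "robust_instance X U" and bdd: "bounded U"
    and x: "m3_optimal X U CARD('n) x"
    and l: "is_arg_min (\<lambda>l. worst_cost U (combination CARD('n) x l)) (convex_weights CARD('n)) l"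
    and c: "c \<in> U"
  shows "c \<bullet> combination CARD('n) x l \<le> m3_opt X U CARD('n)"
proof -
  have U: "convex U" "U \<noteq> {}"
    using inst by (auto simp: robust_instance_def)
  define v where "v = m3_value U CARD('n) x"
  have v: "v \<le> m3_opt X U CARD('n)"
    using x m3_opt_attained[OF inst, of "CARD('n)"]
    unfolding m3_optimal_def is_arg_min_linorder v_def by auto
  have "\<exists>i\<in>{1..CARD('n)}. d \<bullet> x i \<le> v" if "d \<in> U" for d
  proof -
    have "min_cost CARD('n) x d \<le> v"
      unfolding v_def m3_value_def using that bdd
      by (intro cSUP_upper bdd_above_min_cost) auto
    then show ?thesis
      using min_cost_attained[of "CARD('n)" x d] by auto
  qed
  then obtain l' where l': "convex_weights CARD('n) l'"
    "\<And>d. d \<in> U \<Longrightarrow> d \<bullet> combination CARD('n) x l' \<le> v"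
    using minimax_combination[OF U, of x v] by blast
  have "c \<bullet> combination CARD('n) x l \<le> worst_cost U (combination CARD('n) x l)"
    unfolding worst_cost_def using c bdd by (intro cSUP_upper bdd_above_inner)
  also have "\<dots> \<le> worst_cost U (combination CARD('n) x l')"
    using l l'(1) by (simp add: is_arg_min_linorder)
  also have "\<dots> \<le> v"
    unfolding worst_cost_def using l'(2) U by (intro cSUP_least)
  finally show ?thesis
    using v by simp
qed

text \<open>This is the bound \<open>opt(k) / q\<close> with \<open>q = k / n\<close>, stated
  without division.\<close>

lemma selection_output_bound:
  fixes X U :: "(real ^ 'n) set"
  assumes inst: "robust_instance X U" and bdd: "bounded U"
    and out: "selection_output X U k y" and k: "1 \<le> k" "k \<le> CARD('n)"
  shows "real k * m3_value U k y \<le> real CARD('n) * m3_opt X U k"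
proof -
  let ?n = "CARD('n)"
  obtain x l s where x: "m3_optimal X U ?n x"
    and l: "is_arg_min (\<lambda>l. worst_cost U (combination ?n x l)) (convex_weights ?n) l"
    and s: "bij_betw s {1..?n} {1..?n}"
    and sorted: "\<And>i j. \<lbrakk>i \<in> {1..?n}; j \<in> {1..?n}; i \<le> j\<rbrakk> \<Longrightarrow> l (s j) \<le> l (s i)"
    and y: "y = (\<lambda>j\<in>{1..k}. x (s j))"
    using out unfolding selection_output_def by blast
  have weights: "\<And>i. i \<in> {1..?n} \<Longrightarrow> 0 \<le> l i" "(\<Sum>i=1..?n. l i) = 1"
    using l by (auto simp: is_arg_min_def convex_weights_def)
  have xX: "x i \<in> X" if "i \<in> {1..?n}" for i
    using x that by (auto simp: m3_optimal_def is_arg_min_def)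
  have s_in: "s j \<in> {1..?n}" if "j \<in> {1..?n}" for j
    using s that by (rule bij_betwE[rule_format])
  define W where "W = (\<Sum>j=1..k. l (s j))"
  have "real k * (\<Sum>j=1..?n. l (s j)) \<le> real ?n * W"
    unfolding W_def using sorted k by (intro antitone_prefix_sum) auto
  then have W: "real k \<le> real ?n * W"
    using sum.reindex_bij_betw[OF s, of l] weights(2) by simp
  have bound: "real k * min_cost k y c \<le> real ?n * m3_opt X U k" if c: "c \<in> U" for c
  proof -
    have pos: "0 \<le> c \<bullet> x (s j)" if "j \<in> {1..?n}" for j
      using robust_instance_inner_nonneg[OF inst c] xX s_in that by blast
    \<comment> \<open>The sign allows the weight bound \<open>W\<close> to be multiplied by the
      minimal cost.\<close>
    have "0 \<le> min_cost k y c"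
      using pos k by (subst min_cost_ge_iff) (auto simp: y)
    then have "real k * min_cost k y c \<le> real ?n * (W * min_cost k y c)"
      using mult_right_mono[OF W] by (simp add: mult.assoc)
    moreover have "W * min_cost k y c \<le> m3_opt X U k"
    proof -
      have "W * min_cost k y c = (\<Sum>j=1..k. l (s j) * min_cost k y c)"
        by (simp add: W_def sum_distrib_right)
      also have "\<dots> \<le> (\<Sum>j=1..k. l (s j) * (c \<bullet> x (s j)))"
      proof (intro sum_mono mult_left_mono)
        fix j
        assume j: "j \<in> {1..k}"
        then show "min_cost k y c \<le> c \<bullet> x (s j)"
          using min_cost_le[OF j, of y c] by (simp add: y)
        show "0 \<le> l (s j)"
          using j k by (intro weights s_in) auto
      qed
      \<comment> \<open>The solutions that were not selected contribute nonnegative terms, so adding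
        them completes the convex combination.\<close>
      also have "\<dots> \<le> (\<Sum>j=1..?n. l (s j) * (c \<bullet> x (s j)))"
        using k pos weights(1) s_in by (intro sum_mono2) auto
      also have "\<dots> = c \<bullet> combination ?n x l"
        using sum.reindex_bij_betw[OF s, of "\<lambda>i. l i * (c \<bullet> x i)"]
        by (simp add: combination_def inner_sum_right)
      also have "\<dots> \<le> m3_opt X U ?n"
        using optimal_combination_le_m3_opt[OF inst bdd x l c] .
      also have "\<dots> \<le> m3_opt X U k"
        using m3_opt_antimono[OF inst bdd k] .
      finally show ?thesis .
    qed
    ultimately show ?thesis
      by (meson mult_left_mono of_nat_0_le_iff order_trans)
  qed
  have "m3_value U k y \<le> real ?n * m3_opt X U k / real k"
    unfolding m3_value_def
  proof (rule cSUP_least)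
    show "U \<noteq> {}"
      using inst by (simp add: robust_instance_def)
  qed (use bound k in \<open>simp add: field_simps\<close>)
  then show ?thesis
    using k by (simp add: field_simps)
qed

section \<open>The approximation guarantee\<close>

lemma m3_opt_nonneg:
  assumes inst: "robust_instance X U" and "bounded U" "1 \<le> k"
  shows "0 \<le> m3_opt X U k"
proof -
  obtain x where x: "x \<in> {1..k} \<rightarrow>\<^sub>E X" "m3_opt X U k = m3_value U k x"
    using m3_opt_attained[OF inst] by blast
  obtain c where c: "c \<in> U"
    using inst by (auto simp: robust_instance_def)
  have "0 \<le> min_cost k x c"
    using x(1) c assms(3) robust_instance_inner_nonneg[OF inst]
    by (subst min_cost_ge_iff) auto
  also have "\<dots> \<le> m3_value U k x"
    unfolding m3_value_def using c assms by (intro cSUP_upper bdd_above_min_cost)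
  finally show ?thesis
    using x(2) by simp
qed

text \<open>Any member of the nonempty set \<open>X\<close> has its cardinality between the two
  bounds, so both ratios are at least 1.\<close>

lemma M_tilde_ge_1:
  fixes X U :: "(real ^ 'n) set"
  assumes "robust_instance X U" "(X, U) \<in> C" "cardinality_bounds C p_low p_up"
    and "0 < p_low CARD('n)" "cost_bounds U m M"
  shows "1 \<le> M_tilde m M p_low p_up CARD('n)"
proof -
  obtain x where "x \<in> X"
    using assms(1) by (auto simp: robust_instance_def)
  then have "p_low CARD('n) \<le> real (nonzeros x) \<and> real (nonzeros x) \<le> p_up CARD('n)"
    using assms(2,3) unfolding cardinality_bounds_def by blast
  then have "1 \<le> p_up CARD('n) / p_low CARD('n)"
    using assms(4) by simp
  moreover have "1 \<le> M / m"
    using assms(5) by (simp add: cost_bounds_def)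
  ultimately show ?thesis
    unfolding M_tilde_def using mult_mono[of 1 "M / m" 1 "p_up CARD('n) / p_low CARD('n)"] by simp
qed

theorem lemma12:
  fixes C :: "((real ^ 'n) set \<times> (real ^ 'n) set) set"
    and X U :: "(real ^ 'n) set"
    and p_low p_up a :: "nat \<Rightarrow> real"
    and m M q :: real
    and k :: nat
    and y :: "nat \<Rightarrow> real ^ 'n"
  assumes "problem_class C"
    and "\<And>d. 1 \<le> d \<Longrightarrow> 0 \<le> p_low d"
    and "\<And>d. 1 \<le> d \<Longrightarrow> 0 \<le> p_up d"
    and "cardinality_bounds C p_low p_up"
    and "(X, U) \<in> C"
    and "maxima_attained X U"
    and "0 < p_low CARD('n)"
    and "cost_bounds U m M"
    and "\<And>d. 1 \<le> d \<Longrightarrow> 0 \<le> a d"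
    and "0 < q" and "q \<le> 1"
    and "real k = q * real CARD('n)"
    and "q \<in> {M_tilde m M p_low p_up CARD('n) / (M_tilde m M p_low p_up CARD('n) + a CARD('n)) .. 1}"
    and "selection_output X U k y"
  shows "m3_value U k y \<le> (1 + a CARD('n)) * m3_opt X U k"
proof -
  let ?n = "CARD('n)" and ?t = "M_tilde m M p_low p_up CARD('n)"
  have inst: "robust_instance X U"
    using assms(1,5) unfolding problem_class_def by blast
  have bdd: "bounded U"
    using assms(8) by (rule bounded_cost_bounds)
  have n: "1 \<le> ?n"
    by (simp add: Suc_leI)
  have a: "0 \<le> a ?n"
    using assms(9) n .
  have "0 < real k"
    using assms(10,12) by simp
  then have k: "1 \<le> k"
    by simp
  have "real k \<le> real ?n"
    using assms(11,12) by (simp add: mult_left_le_one_le)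
  then have kn: "k \<le> ?n"
    by simp
  have t: "1 \<le> ?t"
    using M_tilde_ge_1[OF inst assms(5,4,7,8)] .
  have "?t / (?t + a ?n) \<le> q"
    using assms(13) by simp
  then have "?t \<le> q * (?t + a ?n)"
    using t a by (simp add: field_simps)
  \<comment> \<open>Enlarging \<open>q * a\<close> by the factor \<open>?t\<close> makes
    \<open>?t\<close> a common factor on the right-hand side, so that it can be cancelled.\<close>
  moreover have "q * a ?n \<le> ?t * (q * a ?n)"
    using mult_right_mono[OF t, of "q * a ?n"] a assms(10) by simp
  ultimately have "?t * 1 \<le> ?t * (q * (1 + a ?n))"
    by (simp add: algebra_simps)
  then have q: "1 \<le> q * (1 + a ?n)"
    using t by (subst (asm) mult_le_cancel_left_pos) auto
  have opt: "0 \<le> m3_opt X U k"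
    using m3_opt_nonneg[OF inst bdd k] .
  \<comment> \<open>Here \<open>k\<close> has been replaced by \<open>q * ?n\<close>, so that the
    dimension cancels.\<close>
  have "?n * (q * m3_value U k y) \<le> ?n * m3_opt X U k"
    using selection_output_bound[OF inst bdd assms(14) k kn] assms(12) by (simp add: mult_ac)
  then have "q * m3_value U k y \<le> m3_opt X U k"
    by (subst (asm) mult_le_cancel_left_pos) auto
  also have "\<dots> \<le> (q * (1 + a ?n)) * m3_opt X U k"
    using mult_right_mono[OF q opt] by simp
  finally have "q * m3_value U k y \<le> q * ((1 + a ?n) * m3_opt X U k)"
    by (simp add: mult.assoc)
  then show ?thesis
    using assms(10) by (subst (asm) mult_le_cancel_left_pos) auto
qed

end
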